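(* Let $T$ be a threshold choosing function satisfying $1$-Goodness. Then $T$ satisfies $2$-Goodness: for every stream $A$, every pair of distinct identifiers $\ell_1\ne\ell_2$ of $A$, and every fixed assignment $X^{n_A}_{-\ell_1,-\ell_2}$ of hash values to the distinct identifiers of $A$ other than $\ell_1,\ell_2$, there exists $F\in(0,1]$ such that the fix-all-but-two projection $f(x,y)=T_{\ell_1,\ell_2}[X^{n_A}_{-\ell_1,-\ell_2}](x,y)$ satisfies: $\max(x,y)<F\Rightarrow f(x,y)=F$, and $\max(x,y)\ge F\Rightarrow f(x,y)\le\max(x,y)$.
   Context: Identifiers come from $[n]$; a stream $A$ is a finite sequence of identifiers with $n_A$ distinct identifiers; hash values lie in $[0,1)$. A threshold choosing function (TCF) $T$ maps (for a fixed target size $k$) each assignment $X^{n_A}$ of hash values to the distinct identifiers of $A$ to a threshold $T(X^{n_A})\in(0,1]$. Fix-all-but-one projection: for a distinct identifier $\ell$ and a fixed assignment $X^{n_A}_{-\ell}$ of hash values to the other distinct identifiers, $T_\ell[X^{n_A}_{-\ell}](x_\ell)=T(X^{n_A})$ where $X^{n_A}$ combines $X^{n_A}_{-\ell}$ and $x_\ell$. A univariate $f$ satisfies $1$-Goodness if there is $F\in(0,1]$ with $x<F\Rightarrow f(x)=F$ and $x\ge F\Rightarrow f(x)\le x$; $T$ satisfies $1$-Goodness if every fix-all-but-one projection (over all streams $A$, identifiers $\ell$, and assignments $X^{n_A}_{-\ell}$) does. Fix-all-but-two projection: $T_{\ell_1,\ell_2}[X^{n_A}_{-\ell_1,-\ell_2}](x,y):=T(X^{n_A})$,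 where $X^{n_A}$ combines $X^{n_A}_{-\ell_1,-\ell_2}$ with hash value $x$ for $\ell_1$ and $y$ for $\ell_2$; it maps $[0,1)\times[0,1)\to(0,1]$. *)

theory Defs
  imports Complex_Main "HOL-Library.FuncSet"
begin

definition streams :: "nat \<Rightarrow> nat list set" where
  "streams n = {A. set A \<subseteq> {1..n}}"

text \<open>Hash assignments to a finite set of identifiers are extensional functions,
  so that an assignment carries no information about identifiers outside its domain.\<close>

definition assignments :: "nat set \<Rightarrow> (nat \<Rightarrow> real) set" where
  "assignments S = S \<rightarrow>\<^sub>E {0..<1}"

text \<open>The target size is fixed throughout and therefore left implicit in \<open>T\<close>.
  The threshold may depend on the stream itself, not only on its set of identifiers.\<close>

definition threshold_choosing_function ::
    "nat \<Rightarrow> (nat list \<Rightarrow> (nat \<Rightarrow> real) \<Rightarrow> real) \<Rightarrow> bool" where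
  "threshold_choosing_function n T \<longleftrightarrow>
    (\<forall>A\<in>streams n. \<forall>X\<in>assignments (set A). T A X \<in> {0<..1})"

text \<open>In the projections, \<open>X\<close> is an assignment to the remaining identifiers of \<open>A\<close>;
  the updates extend it to an element of \<open>assignments (set A)\<close>.\<close>

definition fix_all_but_one ::
    "(nat list \<Rightarrow> (nat \<Rightarrow> real) \<Rightarrow> real) \<Rightarrow> nat list \<Rightarrow> nat \<Rightarrow> (nat \<Rightarrow> real) \<Rightarrow> real \<Rightarrow> real" where
  "fix_all_but_one T A l X x = T A (X(l := x))"

definition fix_all_but_two ::
    "(nat list \<Rightarrow> (nat \<Rightarrow> real) \<Rightarrow> real) \<Rightarrow> nat list \<Rightarrow> nat \<Rightarrow> nat \<Rightarrow> (nat \<Rightarrow> real)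
      \<Rightarrow> real \<Rightarrow> real \<Rightarrow> real" where
  "fix_all_but_two T A l1 l2 X x y = T A (X(l1 := x, l2 := y))"

definition univariate_1_goodness :: "(real \<Rightarrow> real) \<Rightarrow> bool" where
  "univariate_1_goodness f \<longleftrightarrow>
    (\<exists>F\<in>{0<..1}. \<forall>x\<in>{0..<1}. (x < F \<longrightarrow> f x = F) \<and> (x \<ge> F \<longrightarrow> f x \<le> x))"

definition bivariate_2_goodness :: "(real \<Rightarrow> real \<Rightarrow> real) \<Rightarrow> bool" where
  "bivariate_2_goodness f \<longleftrightarrow>
    (\<exists>F\<in>{0<..1}. \<forall>x\<in>{0..<1}. \<forall>y\<in>{0..<1}.
      (max x y < F \<longrightarrow> f x y = F) \<and> (max x y \<ge> F \<longrightarrow> f x y \<le> max x y))"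

definition satisfies_1_goodness ::
    "nat \<Rightarrow> (nat list \<Rightarrow> (nat \<Rightarrow> real) \<Rightarrow> real) \<Rightarrow> bool" where
  "satisfies_1_goodness n T \<longleftrightarrow>
    (\<forall>A\<in>streams n. \<forall>l\<in>set A. \<forall>X\<in>assignments (set A - {l}).
      univariate_1_goodness (fix_all_but_one T A l X))"

definition satisfies_2_goodness ::
    "nat \<Rightarrow> (nat list \<Rightarrow> (nat \<Rightarrow> real) \<Rightarrow> real) \<Rightarrow> bool" where
  "satisfies_2_goodness n T \<longleftrightarrow>
    (\<forall>A\<in>streams n. \<forall>l1\<in>set A. \<forall>l2\<in>set A. l1 \<noteq> l2 \<longrightarrow>
      (\<forall>X\<in>assignments (set A - {l1, l2}).
        bivariate_2_goodness (fix_all_but_two T A l1 l2 X)))"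

end

(* Goodness makes a projection constant below any of its values that exceeds the hash value it is
   taken at. Applied along a row and then along columns, a value f x y > max x y is taken on the
   whole square below f x y, in particular at the origin. Hence F = f 0 0 works: it is positive, and
   a violation f x y > max x y >= F would force f x y = F. *)
theory Submission
  imports Defs
begin

text \<open>From \<open>F\<close> on, \<open>f\<close> never exceeds its argument; so
  \<open>x < f x\<close> forces \<open>x < F\<close> and thus \<open>f x = F\<close>.\<close>

lemma univariate_1_goodness_const_below:
  assumes "univariate_1_goodness f" "x \<in> {0..<1}" "x < f x" "z \<in> {0..<1}" "z < f x"
  shows "f z = f x"
  using assms unfolding univariate_1_goodness_def by (metis linorder_not_le)

lemma bivariate_2_goodnessI:
  fixes f :: "real \<Rightarrow> real \<Rightarrow> real"
  assumes rows: "\<And>y. y \<in> {0..<1} \<Longrightarrow> univariate_1_goodness (\<lambda>x. f x y)"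
    and columns: "\<And>x. x \<in> {0..<1} \<Longrightarrow> univariate_1_goodness (f x)"
  shows "bivariate_2_goodness f"
proof -
  have square: "f u v = f x y"
    if "x \<in> {0..<1}" "y \<in> {0..<1}" "max x y < f x y"
      "u \<in> {0..<1}" "v \<in> {0..<1}" "max u v < f x y" for x y u v
  proof -
    \<comment> \<open>The path turns at \<open>(u, y)\<close>: the value there is still
      \<open>f x y\<close>, hence above both \<open>y\<close> and \<open>v\<close>, as the move
      along column \<open>u\<close> requires.\<close>
    have "f u y = f x y"
      using univariate_1_goodness_const_below[OF rows, of y x u] that by simp
    then show ?thesis
      using univariate_1_goodness_const_below[OF columns, of u y v] that by simp
  qed
  have F: "f 0 0 \<in> {0<..1}"
    using columns[of 0] by (auto simp: univariate_1_goodness_def)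
  show ?thesis
    unfolding bivariate_2_goodness_def
  proof (intro bexI[OF _ F] ballI conjI impI)
    fix x y :: real
    assume xy: "x \<in> {0..<1}" "y \<in> {0..<1}"
    show "f x y = f 0 0" if "max x y < f 0 0"
      using square[of 0 0 x y] that xy F by simp
    show "f x y \<le> max x y" if "f 0 0 \<le> max x y"
    proof (rule ccontr)
      assume "\<not> f x y \<le> max x y"
      \<comment> \<open>The origin lies in the square because
        \<open>f x y > max x y \<ge> 0\<close>.\<close>
      then have "f 0 0 = f x y"
        using square[of x y 0 0] xy by (simp add: not_le)
      then show False
        using that \<open>\<not> f x y \<le> max x y\<close> by simp
    qed
  qed
qed

lemma assignments_fun_upd:
  assumes "X \<in> assignments S" "x \<in> {0..<1}"
  shows "X(l := x) \<in> assignments (insert l S)"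
  using assms unfolding assignments_def by (auto simp: PiE_def extensional_def)

theorem theorem19:
  fixes n :: nat and T :: "nat list \<Rightarrow> (nat \<Rightarrow> real) \<Rightarrow> real"
  assumes "threshold_choosing_function n T"
    and "satisfies_1_goodness n T"
  shows "satisfies_2_goodness n T"
  unfolding satisfies_2_goodness_def
proof (intro ballI impI)
  fix A l1 l2 X
  assume A: "A \<in> streams n" and l: "l1 \<in> set A" "l2 \<in> set A" "l1 \<noteq> l2"
    and X: "X \<in> assignments (set A - {l1, l2})"
  have good: "univariate_1_goodness (fix_all_but_one T A l Y)"
    if "l \<in> set A" "Y \<in> assignments (set A - {l})" for l Y
    using assms(2) A that by (simp add: satisfies_1_goodness_def)
  \<comment> \<open>Assignments are extensional, so each updated domain must be exactly the one in
    \<open>good\<close>.\<close>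
  have ins: "insert l2 (set A - {l1, l2}) = set A - {l1}"
    "insert l1 (set A - {l1, l2}) = set A - {l2}"
    using l by auto
  show "bivariate_2_goodness (fix_all_but_two T A l1 l2 X)"
  proof (rule bivariate_2_goodnessI)
    fix y :: real assume "y \<in> {0..<1}"
    then have "X(l2 := y) \<in> assignments (set A - {l1})"
      using assignments_fun_upd[OF X, of y l2] by (simp only: ins)
    \<comment> \<open>Here \<open>l1\<close> is updated last, but first in
      \<open>fix_all_but_two\<close>; the updates commute as \<open>l1 \<noteq> l2\<close>. For
      columns the orders agree.\<close>
    from good[OF l(1) this] show "univariate_1_goodness (\<lambda>x. fix_all_but_two T A l1 l2 X x y)"
      using l(3) by (simp add: fix_all_but_one_def[abs_def] fix_all_but_two_def fun_upd_twist)
  next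
    fix x :: real assume "x \<in> {0..<1}"
    then have "X(l1 := x) \<in> assignments (set A - {l2})"
      using assignments_fun_upd[OF X, of x l1] by (simp only: ins)
    from good[OF l(2) this] show "univariate_1_goodness (fix_all_but_two T A l1 l2 X x)"
      by (simp add: fix_all_but_one_def[abs_def] fix_all_but_two_def[abs_def])
  qed
qed

end
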